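(* (Skew semi-continuous limit of the one-component C3 lattice equation.) Let $g(s)=s^3+\alpha_2s^2+\alpha_1s+\alpha_0$ with real coefficients, let $p,b_0,b_1\in\mathbb R$, and let $u_{-2},u_{-1},u_0,u_1,u_2:\mathbb R\to\mathbb R$ be smooth. Put $$G=g(p)(u_1-u_{-1})-b_1-b_0u_{-1}+\frac{(3p^2+2\alpha_2p+\alpha_1)(u_1-u_0)(u_0-u_{-1})}{\dot u_0},$$ and fix $\tau\in\mathbb R$ at which $\dot u_0\neq0$, $u_2\neq u_1$, $u_{-1}\neq u_{-2}$ and $G\neq0$. For $\delta\neq0$ small put $q=p-\delta$, $P=g(p)$, $Q=g(q)$ and $x_{\nu,\mu}=u_{\nu+\mu}(\tau+\tfrac12(\nu-\mu)\delta)$ for $\nu,\mu\in\{-1,0,1\}$. Let $$L=\frac{(x_{1,1}-x_{0,1})(x_{-1,1}-x_{0,0})(x_{-1,0}-x_{-1,-1})}{(x_{1,1}-x_{1,0})(x_{0,0}-x_{1,-1})(x_{0,-1}-x_{-1,-1})},\qquad M=\frac{M_1}{M_2},$$ $$M_1=(x_{0,0}-x_{-1,1})(b_0x_{-1,0}+b_1)+(x_{0,1}-x_{-1,1})(x_{-1,0}-x_{0,0})P-(x_{0,1}-x_{0,0})(x_{-1,0}-x_{-1,1})Q,$$ $$M_2=(x_{1,-1}-x_{0,0})(b_0x_{0,-1}+b_1)+(x_{1,0}-x_{0,0})(x_{0,-1}-x_{1,-1})P-(x_{1,0}-x_{1,-1})(x_{0,-1}-x_{0,0})Q.$$ Then,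 as $\delta\to0$, $$\frac{L-M}{\delta}\longrightarrow\partial_\tau\log|G|-\frac{\dot u_{-1}}{u_{-1}-u_{-2}}+\frac{\dot u_1}{u_2-u_1},$$ evaluated at $\tau$; thus the leading-order equation is $$\partial_\tau\log G=\frac{\dot u_{-1}}{u_{-1}-u_{-2}}-\frac{\dot u_1}{u_2-u_1}.$$
   Context: Dots denote derivatives with respect to $\tau$; $\partial_\tau \log G$ means $\dot G/G$. $L=M$ is the one-component equation (in the variable $x$) of the C3 lattice system, on a $3\times3$ stencil centred at the origin. *)

theory Defs
  imports "HOL-Analysis.Analysis" "HOL-Library.Landau_Symbols"
begin

definition smooth_real :: "(real \<Rightarrow> real) \<Rightarrow> bool" where
  "smooth_real f \<longleftrightarrow> (\<forall>n. (deriv ^^ n) f differentiable_on UNIV)"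

(* The notation "d/dt log G" stands for the quotient G'/G, also where G is negative. *)
definition log_deriv :: "(real \<Rightarrow> real) \<Rightarrow> real \<Rightarrow> real" where
  "log_deriv G t = deriv G t / G t"

definition cubic :: "real \<Rightarrow> real \<Rightarrow> real \<Rightarrow> real \<Rightarrow> real" where
  "cubic \<alpha>0 \<alpha>1 \<alpha>2 s = s^3 + \<alpha>2 * s^2 + \<alpha>1 * s + \<alpha>0"

text \<open>
  The one-component C3 lattice equation is \<open>C3_L x = C3_M b0 b1 P Q x\<close>, where only
  \<open>x \<nu> \<mu>\<close> with \<open>\<nu>, \<mu> \<in> {-1, 0, 1}\<close> occur. The denominators are named separately because
  the equation is meaningful only where they do not vanish.
\<close>

definition C3_L1 :: "(int \<Rightarrow> int \<Rightarrow> real) \<Rightarrow> real" where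
  "C3_L1 x = (x 1 1 - x 0 1) * (x (-1) 1 - x 0 0) * (x (-1) 0 - x (-1) (-1))"

definition C3_L2 :: "(int \<Rightarrow> int \<Rightarrow> real) \<Rightarrow> real" where
  "C3_L2 x = (x 1 1 - x 1 0) * (x 0 0 - x 1 (-1)) * (x 0 (-1) - x (-1) (-1))"

definition C3_L :: "(int \<Rightarrow> int \<Rightarrow> real) \<Rightarrow> real" where
  "C3_L x = C3_L1 x / C3_L2 x"

definition C3_M1 :: "real \<Rightarrow> real \<Rightarrow> real \<Rightarrow> real \<Rightarrow> (int \<Rightarrow> int \<Rightarrow> real) \<Rightarrow> real" where
  "C3_M1 b0 b1 P Q x =
     (x 0 0 - x (-1) 1) * (b0 * x (-1) 0 + b1)
     + (x 0 1 - x (-1) 1) * (x (-1) 0 - x 0 0) * P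
     - (x 0 1 - x 0 0) * (x (-1) 0 - x (-1) 1) * Q"

definition C3_M2 :: "real \<Rightarrow> real \<Rightarrow> real \<Rightarrow> real \<Rightarrow> (int \<Rightarrow> int \<Rightarrow> real) \<Rightarrow> real" where
  "C3_M2 b0 b1 P Q x =
     (x 1 (-1) - x 0 0) * (b0 * x 0 (-1) + b1)
     + (x 1 0 - x 0 0) * (x 0 (-1) - x 1 (-1)) * P
     - (x 1 0 - x 1 (-1)) * (x 0 (-1) - x 0 0) * Q"

definition C3_M :: "real \<Rightarrow> real \<Rightarrow> real \<Rightarrow> real \<Rightarrow> (int \<Rightarrow> int \<Rightarrow> real) \<Rightarrow> real" where
  "C3_M b0 b1 P Q x = C3_M1 b0 b1 P Q x / C3_M2 b0 b1 P Q x"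

definition skew_stencil :: "(int \<Rightarrow> real \<Rightarrow> real) \<Rightarrow> real \<Rightarrow> real \<Rightarrow> int \<Rightarrow> int \<Rightarrow> real" where
  "skew_stencil u \<tau> \<delta> \<nu> \<mu> = u (\<nu> + \<mu>) (\<tau> + 1/2 * of_int (\<nu> - \<mu>) * \<delta>)"

definition skew_G ::
  "real \<Rightarrow> real \<Rightarrow> real \<Rightarrow> real \<Rightarrow> real \<Rightarrow> real \<Rightarrow> (int \<Rightarrow> real \<Rightarrow> real) \<Rightarrow> real \<Rightarrow> real" where
  "skew_G \<alpha>0 \<alpha>1 \<alpha>2 b0 b1 p u t =
     cubic \<alpha>0 \<alpha>1 \<alpha>2 p * (u 1 t - u (-1) t) - b1 - b0 * u (-1) t
     + (3 * p^2 + 2 * \<alpha>2 * p + \<alpha>1) * (u 1 t - u 0 t) * (u 0 t - u (-1) t) / deriv (u 0) t"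

end

(* Write s(h) = (u_0(tau+h) - u_0(tau))/h and P - Q = delta K(delta). Each of M_1 and M_2 contains
   its own difference quotient of u_0 as a factor: M_1 = - delta s(-delta) A(delta) and
   M_2 = - delta s(delta) B(delta), where A and B are differentiable at 0 with A(0) = B(0) = G(tau).
   Since L has the same prefactor, L - M = s(-delta)/s(delta) * ((R - 1) - (A - B)/B) with R(0) = 1,
   and the limit is R'(0) - (A - B)'(0)/G(tau), in which (A - B)'(0) = - G'(tau). Second derivatives
   of u_0 enter through s'(0) = u_0''(tau)/2. *)
theory Submission
  imports Defs
begin

text \<open>The value at \<open>h = 0\<close> is the limit of the quotients, so for differentiable
  \<open>f\<close> the function is continuous there and can be differentiated like any
  other.\<close>

definition slope :: "(real \<Rightarrow> real) \<Rightarrow> real \<Rightarrow> real \<Rightarrow> real" where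
  "slope f t h = (if h = 0 then deriv f t else (f (t + h) - f t) / h)"

lemma slope_mult: "h * slope f t h = f (t + h) - f t"
  by (simp add: slope_def)

text \<open>The difference quotient of \<open>slope f t\<close> at 0 is the first-order Taylor
  remainder over \<open>h\<^sup>2\<close>. One application of l'Hopital leaves
  \<open>(deriv f (t + h) - deriv f t) / (2 * h)\<close>, whose limit is the definition of the
  second derivative; hence \<open>deriv f\<close> need only be differentiable at the point
  \<open>t\<close>.\<close>

lemma slope_has_real_derivative:
  assumes f: "\<And>t. (f has_real_derivative deriv f t) (at t)"
    and f': "(deriv f has_real_derivative c) (at t)"
  shows "(slope f t has_real_derivative c / 2) (at 0)"
proof -
  have num: "((\<lambda>h. f (t + h) - f t - h * deriv f t) has_real_derivative deriv f (t + h) - deriv f t) (at h)"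
    for h
    using f[of "h + t"] by (auto intro!: derivative_eq_intros simp: DERIV_shift add.commute[of t])
  have "((\<lambda>h. (f (t + h) - f t - h * deriv f t) / h\<^sup>2) \<longlongrightarrow> c / 2) (at 0)"
  proof (rule lhopital)
    have "isCont (\<lambda>h. f (t + h) - f t - h * deriv f t) 0"
      using num DERIV_isCont by blast
    then show "(\<lambda>h. f (t + h) - f t - h * deriv f t) \<midarrow>0\<rightarrow> 0"
      by (simp add: isCont_def)
    show "(\<lambda>h::real. h\<^sup>2) \<midarrow>0\<rightarrow> 0"
      by (auto intro!: tendsto_eq_intros)
    show "\<forall>\<^sub>F h in at 0. h\<^sup>2 \<noteq> (0::real)" "\<forall>\<^sub>F h in at 0. 2 * h \<noteq> (0::real)"
      by (auto simp: eventually_at_filter)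
    show "\<forall>\<^sub>F h in at 0. ((\<lambda>h. f (t + h) - f t - h * deriv f t) has_real_derivative
        deriv f (t + h) - deriv f t) (at h)"
      using num by simp
    show "\<forall>\<^sub>F h in at 0. ((\<lambda>h. h\<^sup>2) has_real_derivative 2 * h) (at (h::real))"
      by (auto intro!: derivative_eq_intros always_eventually)
    have "(\<lambda>h. (deriv f (t + h) - deriv f t) / h) \<midarrow>0\<rightarrow> c"
      using f' by (simp add: DERIV_def)
    then have "(\<lambda>h. (deriv f (t + h) - deriv f t) / h / 2) \<midarrow>0\<rightarrow> c / 2"
      by (intro tendsto_divide) auto
    then show "(\<lambda>h. (deriv f (t + h) - deriv f t) / (2 * h)) \<midarrow>0\<rightarrow> c / 2"
      by (simp add: mult.commute)
  qed
  moreover have "\<forall>\<^sub>F h in at 0. (f (t + h) - f t - h * deriv f t) / h\<^sup>2 = (slope f t (0 + h) - slope f t 0) / h"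
    unfolding eventually_at_filter
    by (rule always_eventually) (auto simp: slope_def field_simps power2_eq_square)
  ultimately show ?thesis
    unfolding DERIV_def by (rule Lim_transform_eventually)
qed

text \<open>On the half-line containing \<open>y\<close>, the function
  \<open>ln \<bar>y\<bar>\<close> is \<open>ln y\<close> or \<open>ln (- y)\<close>, and both have
  derivative \<open>1 / y\<close>; the rest is the chain rule.\<close>

lemma has_real_derivative_ln_abs:
  assumes "(f has_real_derivative f') (at t)" "f t \<noteq> (0::real)"
  shows "((\<lambda>t. ln \<bar>f t\<bar>) has_real_derivative f' / f t) (at t)"
proof -
  have "((\<lambda>y. ln \<bar>y\<bar>) has_real_derivative inverse y) (at y)" if "y \<noteq> 0" for y :: real
  proof (cases "y > 0")
    case True
    show ?thesis
      by (rule has_field_derivative_transform_within_open[of ln _ _ "{0<..}"])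
         (use True in \<open>auto intro!: derivative_eq_intros simp: inverse_eq_divide\<close>)
  next
    case False
    show ?thesis
      by (rule has_field_derivative_transform_within_open[of "\<lambda>y. ln (- y)" _ _ "{..<0}"])
         (use False that in \<open>auto intro!: derivative_eq_intros simp: inverse_eq_divide\<close>)
  qed
  from DERIV_chain2[OF this[OF assms(2)] assms(1)] show ?thesis
    by (simp add: field_simps)
qed

lemma smooth_real_DERIV:
  assumes "smooth_real f"
  shows "(f has_real_derivative deriv f t) (at t)"
    and "(deriv f has_real_derivative deriv (deriv f) t) (at t)"
proof -
  have "(deriv ^^ n) f differentiable at t" for n
    using assms by (auto simp: smooth_real_def differentiable_on_def)
  from this[of 0] this[of 1] show "(f has_real_derivative deriv f t) (at t)"
    and "(deriv f has_real_derivative deriv (deriv f) t) (at t)"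
    by (auto simp: real_differentiable_def intro!: DERIV_deriv_iff_real_differentiable[THEN iffD2])
qed

text \<open>Converts the computed limit into the leading-order equation: the lattice equation holds
  to first order exactly when that limit vanishes, by uniqueness of limits.\<close>

lemma smallo_ident_iff_limit_zero:
  assumes "((\<lambda>\<delta>. f \<delta> / \<delta>) \<longlongrightarrow> c) (at (0::real))"
  shows "f \<in> o[at 0](\<lambda>\<delta>. \<delta>) \<longleftrightarrow> c = (0::real)"
proof
  assume "f \<in> o[at 0](\<lambda>\<delta>. \<delta>)"
  from smalloD_tendsto[OF this] assms show "c = 0"
    by (auto intro: tendsto_unique[rotated])
next
  assume "c = 0"
  with assms show "f \<in> o[at 0](\<lambda>\<delta>. \<delta>)"
    by (intro smalloI_tendsto) (auto simp: eventually_at_filter)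
qed

text \<open>
  The common shape of the cofactors of \<open>M\<^sub>1\<close> and \<open>M\<^sub>2\<close>: \<open>M\<^sub>1\<close> belongs to step \<open>h = - \<delta>\<close> and parameter \<open>Q\<close>,
  \<open>M\<^sub>2\<close> to step \<open>h = \<delta>\<close> and parameter \<open>P\<close>. At \<open>h = 0\<close> it becomes \<open>skew_G\<close>.
\<close>

definition skew_factor ::
  "real \<Rightarrow> real \<Rightarrow> (int \<Rightarrow> real \<Rightarrow> real) \<Rightarrow> real \<Rightarrow> real \<Rightarrow> real \<Rightarrow> real \<Rightarrow> real" where
  "skew_factor b0 b1 u \<tau> P K h =
     P * (u 1 (\<tau> + h / 2) - u (-1) (\<tau> + h / 2)) - b1 - b0 * u (-1) (\<tau> + h / 2)
     + K * (u 1 (\<tau> + h / 2) - u 0 (\<tau> + h)) * (u 0 \<tau> - u (-1) (\<tau> + h / 2)) / slope (u 0) \<tau> h"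

text \<open>Eliminating \<open>P\<close> leaves the coefficient
  \<open>(v - a) * (w - y) - (v - y) * (w - a) = - (y - a) * (v - w)\<close> at \<open>Q\<close>,
  where \<open>y = u 0 \<tau>\<close> and \<open>y - a = \<delta> * s\<close>. The
  \<open>b0\<close>, \<open>b1\<close> terms carry the same factor \<open>y - a\<close>, and the
  remaining term carries \<open>\<delta> * K\<close>, so \<open>\<delta>\<close> factors out of
  everything.\<close>

lemma C3_M1_skew_stencil:
  assumes "slope (u 0) \<tau> (- \<delta>) \<noteq> 0" and "P - Q = \<delta> * K"
  shows "C3_M1 b0 b1 P Q (skew_stencil u \<tau> \<delta>)
       = - \<delta> * slope (u 0) \<tau> (- \<delta>) * skew_factor b0 b1 u \<tau> Q K (- \<delta>)"
proof -
  define s where "s = slope (u 0) \<tau> (- \<delta>)"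
  define a where "a = u 0 (\<tau> - \<delta>)"
  define v where "v = u 1 (\<tau> - \<delta> / 2)"
  define w where "w = u (-1) (\<tau> - \<delta> / 2)"
  have a: "u 0 \<tau> = a + \<delta> * s"
    using slope_mult[of "- \<delta>" "u 0" \<tau>] by (simp add: s_def a_def)
  have P: "P = Q + \<delta> * K"
    using assms by simp
  have "C3_M1 b0 b1 P Q (skew_stencil u \<tau> \<delta>)
      = (u 0 \<tau> - a) * (b0 * w + b1) + (v - a) * (w - u 0 \<tau>) * P - (v - u 0 \<tau>) * (w - a) * Q"
    by (simp add: C3_M1_def skew_stencil_def a_def v_def w_def field_simps)
  also have "\<dots> = - \<delta> * (s * (Q * (v - w) - b1 - b0 * w) + K * (v - a) * (u 0 \<tau> - w))"
    unfolding a P by algebra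
  also have "\<dots> = - \<delta> * s * ((Q * (v - w) - b1 - b0 * w) + K * (v - a) * (u 0 \<tau> - w) / s)"
    using assms(1) by (simp add: field_simps flip: s_def)
  also have "(Q * (v - w) - b1 - b0 * w) + K * (v - a) * (u 0 \<tau> - w) / s
      = skew_factor b0 b1 u \<tau> Q K (- \<delta>)"
    by (simp add: skew_factor_def s_def a_def v_def w_def)
  finally show ?thesis by (simp add: s_def)
qed

text \<open>Up to sign this is the computation for \<open>C3_M1\<close> with \<open>\<delta>\<close>
  replaced by \<open>- \<delta>\<close> and \<open>P\<close>, \<open>Q\<close> exchanged, which
  preserves \<open>P - Q = \<delta> * K\<close>; therefore \<open>Q\<close> is eliminated
  here.\<close>

lemma C3_M2_skew_stencil:
  assumes "slope (u 0) \<tau> \<delta> \<noteq> 0" and "P - Q = \<delta> * K"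
  shows "C3_M2 b0 b1 P Q (skew_stencil u \<tau> \<delta>)
       = - \<delta> * slope (u 0) \<tau> \<delta> * skew_factor b0 b1 u \<tau> P K \<delta>"
proof -
  define s where "s = slope (u 0) \<tau> \<delta>"
  define a where "a = u 0 (\<tau> + \<delta>)"
  define v where "v = u 1 (\<tau> + \<delta> / 2)"
  define w where "w = u (-1) (\<tau> + \<delta> / 2)"
  have a: "u 0 \<tau> = a - \<delta> * s"
    using slope_mult[of \<delta> "u 0" \<tau>] by (simp add: s_def a_def)
  have Q: "Q = P - \<delta> * K"
    using assms by simp
  have "C3_M2 b0 b1 P Q (skew_stencil u \<tau> \<delta>)
      = (a - u 0 \<tau>) * (b0 * w + b1) + (v - u 0 \<tau>) * (w - a) * P - (v - a) * (w - u 0 \<tau>) * Q"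
    by (simp add: C3_M2_def skew_stencil_def a_def v_def w_def field_simps)
  also have "\<dots> = - \<delta> * (s * (P * (v - w) - b1 - b0 * w) + K * (v - a) * (u 0 \<tau> - w))"
    unfolding a Q by algebra
  also have "\<dots> = - \<delta> * s * ((P * (v - w) - b1 - b0 * w) + K * (v - a) * (u 0 \<tau> - w) / s)"
    using assms(1) by (simp add: field_simps flip: s_def)
  also have "(P * (v - w) - b1 - b0 * w) + K * (v - a) * (u 0 \<tau> - w) / s
      = skew_factor b0 b1 u \<tau> P K \<delta>"
    by (simp add: skew_factor_def s_def a_def v_def w_def)
  finally show ?thesis by (simp add: s_def)
qed

text \<open>The parameter \<open>c\<close> is the direction of the step, so one formula serves both
  cofactors (\<open>c = - 1\<close> and \<open>c = 1\<close>). The coefficient 2 of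
  \<open>deriv (u 0) \<tau>\<close> arises because \<open>u 0\<close> is shifted by a full step and
  its neighbours by half a step, while the other occurrence of \<open>u 0\<close> stays at
  \<tau>.\<close>

lemma skew_factor_has_real_derivative:
  assumes u: "\<forall>i\<in>{-1, 0, 1}. smooth_real (u i)"
    and nz: "deriv (u 0) \<tau> \<noteq> 0"
    and P: "(P has_real_derivative P') (at 0)"
    and K: "(K has_real_derivative K') (at 0)"
  shows "((\<lambda>\<delta>. skew_factor b0 b1 u \<tau> (P \<delta>) (K \<delta>) (c * \<delta>)) has_real_derivative
      P' * (u 1 \<tau> - u (-1) \<tau>)
      + K' * (u 1 \<tau> - u 0 \<tau>) * (u 0 \<tau> - u (-1) \<tau>) / deriv (u 0) \<tau>
      + c / 2 * (P 0 * (deriv (u 1) \<tau> - deriv (u (-1)) \<tau>) - b0 * deriv (u (-1)) \<tau>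
        + K 0 * ((deriv (u 1) \<tau> - 2 * deriv (u 0) \<tau>) * (u 0 \<tau> - u (-1) \<tau>)
            - (u 1 \<tau> - u 0 \<tau>) * deriv (u (-1)) \<tau>) / deriv (u 0) \<tau>
        - K 0 * (u 1 \<tau> - u 0 \<tau>) * (u 0 \<tau> - u (-1) \<tau>) * deriv (deriv (u 0)) \<tau>
            / (deriv (u 0) \<tau>)\<^sup>2)) (at 0)"
proof -
  have d: "((\<lambda>\<delta>. u i (\<tau> + e * \<delta>)) has_real_derivative deriv (u i) \<tau> * e) (at 0)"
    if "i \<in> {-1, 0, 1}" for i e
    by (rule DERIV_chain2[of "u i"])
      (use smooth_real_DERIV(1)[OF bspec[OF u that]] in \<open>auto intro!: derivative_eq_intros\<close>)
  have s0: "slope (u 0) \<tau> 0 = deriv (u 0) \<tau>"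
    by (simp add: slope_def)
  have s: "((\<lambda>\<delta>. slope (u 0) \<tau> (c * \<delta>)) has_real_derivative deriv (deriv (u 0)) \<tau> / 2 * c) (at 0)"
    by (rule DERIV_chain2[of "slope (u 0) \<tau>"])
      (auto intro!: derivative_eq_intros slope_has_real_derivative smooth_real_DERIV bspec[OF u])
  have d2: "((\<lambda>\<delta>. u i (\<tau> + c * \<delta> / 2)) has_real_derivative deriv (u i) \<tau> * (c / 2)) (at 0)"
    if "i \<in> {-1, 0, 1}" for i
    using d[OF that, of "c / 2"] by simp
  note dd = d2[of 1, simplified] d2[of "-1", simplified] d[of 0 c, simplified]
  show ?thesis
    unfolding skew_factor_def
    apply (rule DERIV_cong)
     apply (rule P K s dd derivative_intros | simp add: s0 nz)+
    using nz by (simp add: s0 field_simps power2_eq_square)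
qed

lemma skew_G_has_real_derivative:
  assumes u: "\<forall>i\<in>{-1, 0, 1}. smooth_real (u i)"
    and nz: "deriv (u 0) \<tau> \<noteq> 0"
  shows "(skew_G \<alpha>0 \<alpha>1 \<alpha>2 b0 b1 p u has_real_derivative
      cubic \<alpha>0 \<alpha>1 \<alpha>2 p * (deriv (u 1) \<tau> - deriv (u (-1)) \<tau>) - b0 * deriv (u (-1)) \<tau>
      + (3 * p^2 + 2 * \<alpha>2 * p + \<alpha>1) *
        (((deriv (u 1) \<tau> - deriv (u 0) \<tau>) * (u 0 \<tau> - u (-1) \<tau>)
            + (u 1 \<tau> - u 0 \<tau>) * (deriv (u 0) \<tau> - deriv (u (-1)) \<tau>)) / deriv (u 0) \<tau>
         - (u 1 \<tau> - u 0 \<tau>) * (u 0 \<tau> - u (-1) \<tau>) * deriv (deriv (u 0)) \<tau>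
            / (deriv (u 0) \<tau>)\<^sup>2)) (at \<tau>)"
proof -
  note dd = smooth_real_DERIV(1)[OF bspec[OF u], of 1 \<tau>] smooth_real_DERIV(1)[OF bspec[OF u], of "-1" \<tau>]
     smooth_real_DERIV(1)[OF bspec[OF u], of 0 \<tau>] smooth_real_DERIV(2)[OF bspec[OF u], of 0 \<tau>]
  show ?thesis
    unfolding skew_G_def
    apply (rule derivative_eq_intros dd[simplified] | simp add: nz)+
    using nz by (simp add: field_simps power2_eq_square)
qed

text \<open>The ratio has the form F(-\<delta>)/F(\<delta>), whose derivative at 0 is -2 F'(0)/F(0);
  the half steps in the arguments cancel the 2.\<close>

lemma stencil_ratio_has_real_derivative:
  assumes v: "(v has_real_derivative v') (at \<tau>)" and w: "(w has_real_derivative w') (at \<tau>)"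
    and nz: "c \<noteq> v \<tau>" "w \<tau> \<noteq> d"
  shows "((\<lambda>\<delta>. (c - v (\<tau> - \<delta> / 2)) * (w (\<tau> - \<delta> / 2) - d)
                / ((c - v (\<tau> + \<delta> / 2)) * (w (\<tau> + \<delta> / 2) - d)))
           has_real_derivative v' / (c - v \<tau>) - w' / (w \<tau> - d)) (at 0)"
proof -
  have shift: "((\<lambda>\<delta>. f (\<tau> - \<delta> / 2)) has_real_derivative f' * (- 1 / 2)) (at 0)"
    "((\<lambda>\<delta>. f (\<tau> + \<delta> / 2)) has_real_derivative f' * (1 / 2)) (at 0)"
    if "(f has_real_derivative f') (at \<tau>)" for f f'
    by (rule DERIV_chain2[of f]; use that in \<open>auto intro!: derivative_eq_intros\<close>)+
  define X where "X = c - v \<tau>"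
  define Y where "Y = w \<tau> - d"
  have XY: "X \<noteq> 0" "Y \<noteq> 0"
    using nz by (simp_all add: X_def Y_def)
  show ?thesis
    apply (rule DERIV_cong)
     apply (rule shift[OF v] shift[OF w] derivative_intros | simp add: nz)+
    using XY by (simp add: field_simps flip: X_def Y_def)
qed

theorem mainTheorem12:
  fixes \<alpha>0 \<alpha>1 \<alpha>2 b0 b1 p \<tau> :: real
    and u :: "int \<Rightarrow> real \<Rightarrow> real"
    and g G :: "real \<Rightarrow> real"
    and x :: "real \<Rightarrow> int \<Rightarrow> int \<Rightarrow> real"
    and L M :: "real \<Rightarrow> real"
  assumes smooth: "\<And>i. i \<in> {-2..2} \<Longrightarrow> smooth_real (u i)"
    and g: "g = cubic \<alpha>0 \<alpha>1 \<alpha>2"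
    and G: "G = skew_G \<alpha>0 \<alpha>1 \<alpha>2 b0 b1 p u"
    and x: "x = skew_stencil u \<tau>"
    and L: "L = (\<lambda>\<delta>. C3_L (x \<delta>))"
    and M: "M = (\<lambda>\<delta>. C3_M b0 b1 (g p) (g (p - \<delta>)) (x \<delta>))"
    and "deriv (u 0) \<tau> \<noteq> 0"
    and "u 2 \<tau> \<noteq> u 1 \<tau>"
    and "u (-1) \<tau> \<noteq> u (-2) \<tau>"
    and "G \<tau> \<noteq> 0"
  shows "(G differentiable (at \<tau>)) \<and>
    (\<forall>\<^sub>F \<delta> in at 0. C3_L2 (x \<delta>) \<noteq> 0 \<and> C3_M2 b0 b1 (g p) (g (p - \<delta>)) (x \<delta>) \<noteq> 0) \<and>
    (((\<lambda>\<delta>. (L \<delta> - M \<delta>) / \<delta>) \<longlongrightarrow>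
           deriv (\<lambda>t. ln \<bar>G t\<bar>) \<tau>
           - deriv (u (-1)) \<tau> / (u (-1) \<tau> - u (-2) \<tau>)
           + deriv (u 1) \<tau> / (u 2 \<tau> - u 1 \<tau>)) (at 0)) \<and>
    ((\<lambda>\<delta>. L \<delta> - M \<delta>) \<in> o[at 0](\<lambda>\<delta>. \<delta>) \<longleftrightarrow>
           log_deriv G \<tau> =
             deriv (u (-1)) \<tau> / (u (-1) \<tau> - u (-2) \<tau>) - deriv (u 1) \<tau> / (u 2 \<tau> - u 1 \<tau>))"
proof -
  have sm: "\<forall>i\<in>{-1, 0, 1}. smooth_real (u i)"
    using smooth by auto
  have nz: "deriv (u 0) \<tau> \<noteq> 0" "u 2 \<tau> \<noteq> u 1 \<tau>" "u (-1) \<tau> \<noteq> u (-2) \<tau>" "G \<tau> \<noteq> 0"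
    by fact+
  define s where "s = slope (u 0) \<tau>"
  \<comment> \<open>The quotient \<open>(g p - g (p - \<delta>)) / \<delta>\<close> with \<delta>
    divided out as a polynomial, so that \<open>K 0\<close> is the derivative of \<open>g\<close> at
    \<open>p\<close>.\<close>
  define K where "K \<delta> = 3 * p\<^sup>2 + 2 * \<alpha>2 * p + \<alpha>1 - \<delta> * (3 * p + \<alpha>2) + \<delta>\<^sup>2" for \<delta>
  \<comment> \<open>The factors \<open>- 1\<close> and \<open>1\<close> are written out so that
    instances of the derivative lemma with \<open>c * \<delta>\<close> fold into \<open>A\<close>
    and \<open>B\<close>.\<close>
  define A where "A \<delta> = skew_factor b0 b1 u \<tau> (g p - \<delta> * K \<delta>) (K \<delta>) (- 1 * \<delta>)" for \<delta>
  define B where "B \<delta> = skew_factor b0 b1 u \<tau> (g p) (K \<delta>) (1 * \<delta>)" for \<delta>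
  \<comment> \<open>What remains of \<open>L\<close> once \<open>s (- \<delta>) / s \<delta>\<close>
    is removed; the corner values \<open>u 2\<close> and \<open>u (-2)\<close> are not shifted in
    time.\<close>
  define R where "R \<delta> = (u 2 \<tau> - u 1 (\<tau> - \<delta> / 2)) * (u (-1) (\<tau> - \<delta> / 2) - u (-2) \<tau>)
      / ((u 2 \<tau> - u 1 (\<tau> + \<delta> / 2)) * (u (-1) (\<tau> + \<delta> / 2) - u (-2) \<tau>))" for \<delta>
  define c where "c = deriv G \<tau> / G \<tau> - deriv (u (-1)) \<tau> / (u (-1) \<tau> - u (-2) \<tau>)
      + deriv (u 1) \<tau> / (u 2 \<tau> - u 1 \<tau>)"

  have gq: "g (p - \<delta>) = g p - \<delta> * K \<delta>" for \<delta>
    unfolding g cubic_def K_def by algebra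
  have DK: "(K has_real_derivative - (3 * p + \<alpha>2)) (at 0)"
    unfolding K_def by (auto intro!: derivative_eq_intros)
  have DQ: "((\<lambda>\<delta>. g p - \<delta> * K \<delta>) has_real_derivative - K 0) (at 0)"
    by (auto intro!: derivative_eq_intros DK)
  have DP: "((\<lambda>\<delta>. g p) has_real_derivative 0) (at (0::real))"
    by simp
  note DA = skew_factor_has_real_derivative[where c = "- 1" and u = u and \<tau> = \<tau>
      and P = "\<lambda>\<delta>. g p - \<delta> * K \<delta>" and K = K and ?b0.0 = b0 and ?b1.0 = b1,
      OF sm nz(1) DQ DK, folded A_def]
  note DB = skew_factor_has_real_derivative[where c = 1 and u = u and \<tau> = \<tau>
      and P = "\<lambda>\<delta>. g p" and K = K and ?b0.0 = b0 and ?b1.0 = b1,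
      OF sm nz(1) DP DK, folded B_def]
  note DG = skew_G_has_real_derivative[of u \<tau> \<alpha>0 \<alpha>1 \<alpha>2 b0 b1 p, OF sm nz(1), folded G]
  have K0: "K 0 = 3 * p\<^sup>2 + 2 * \<alpha>2 * p + \<alpha>1"
    by (simp add: K_def)
  note dG = DERIV_imp_deriv[OF DG, folded K0 g]
  have A0: "A 0 = G \<tau>" and B0: "B 0 = G \<tau>"
    by (simp_all add: A_def B_def G skew_G_def skew_factor_def g K_def slope_def)
  have R0: "R 0 = 1"
    using nz by (simp add: R_def)
  have DR: "(R has_real_derivative deriv (u 1) \<tau> / (u 2 \<tau> - u 1 \<tau>)
      - deriv (u (-1)) \<tau> / (u (-1) \<tau> - u (-2) \<tau>)) (at 0)"
    unfolding R_def using nz sm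
    by (intro stencil_ratio_has_real_derivative smooth_real_DERIV) auto
  \<comment> \<open>The contributions of the derivative of \<open>K\<close> cancel and the two
    \<open>c / 2\<close> parts combine to coefficient -1. The term
    \<open>- K 0 * (u 1 \<tau> - u (-1) \<tau>)\<close> from the varying parameter in
    \<open>A\<close> makes up for the asymmetric \<open>2 * deriv (u 0) \<tau>\<close>, and exactly
    \<open>- deriv G \<tau>\<close> results.\<close>
  have DAB: "((\<lambda>\<delta>. A \<delta> - B \<delta>) has_real_derivative - deriv G \<tau>) (at 0)"
    apply (rule DERIV_cong[OF DERIV_diff[OF DA DB]])
    using nz(1) by (simp add: dG field_simps power2_eq_square)
  \<comment> \<open>The value of \<open>B'\<close> does not matter: in the quotient rule it is
    multiplied by \<open>A 0 - B 0 = 0\<close>.\<close>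
  obtain B' where DB': "(B has_real_derivative B') (at 0)"
    using DB by blast
  have Drem: "((\<lambda>\<delta>. (R \<delta> - 1) - (A \<delta> - B \<delta>) / B \<delta>) has_real_derivative c) (at 0)"
    apply (rule DERIV_cong)
     apply (rule DR DAB DB' derivative_intros | simp add: B0 nz)+
    using nz by (simp add: A0 B0 c_def)
  have s0: "s 0 = deriv (u 0) \<tau>"
    by (simp add: s_def slope_def)
  have scont: "isCont s 0"
    unfolding s_def
    by (rule DERIV_isCont, rule slope_has_real_derivative; rule smooth_real_DERIV; simp add: sm)
  then have slim: "s \<midarrow>0\<rightarrow> deriv (u 0) \<tau>"
    by (simp add: isCont_def s0)
  have slim': "(\<lambda>\<delta>. s (- \<delta>)) \<midarrow>0\<rightarrow> deriv (u 0) \<tau>"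
    using isCont_o2[of 0 "\<lambda>\<delta>. - \<delta>" s, OF isCont_minus[OF continuous_ident]] scont
    by (simp add: isCont_def s0)
  have ucont: "(\<lambda>\<delta>. u i (\<tau> + \<delta> / 2)) \<midarrow>0\<rightarrow> u i \<tau>" if "i \<in> {-1, 0, 1}" for i
    by (rule isCont_tendsto_compose[OF DERIV_isCont[OF smooth_real_DERIV(1)[OF bspec[OF sm that]]]])
       (auto intro!: tendsto_eq_intros)
  \<comment> \<open>The nonvanishing facts collected from here on cover all factors of the two
    denominators, together with \<open>s (- \<delta>)\<close>, which the factorization of
    \<open>C3_M1\<close> divides by.\<close>
  have "\<forall>\<^sub>F \<delta> in at 0. B \<delta> \<noteq> 0"
    using DERIV_isCont[OF DB'] nz(4) B0
    by (intro tendsto_imp_eventually_ne[of _ "G \<tau>"]) (auto simp: isCont_def)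
  moreover have "\<forall>\<^sub>F \<delta> in at 0. s \<delta> \<noteq> 0" "\<forall>\<^sub>F \<delta> in at 0. s (- \<delta>) \<noteq> 0"
    using tendsto_imp_eventually_ne[OF slim] tendsto_imp_eventually_ne[OF slim'] nz by auto
  moreover have "\<forall>\<^sub>F \<delta> in at 0. u 1 (\<tau> + \<delta> / 2) \<noteq> u 2 \<tau>"
    by (rule tendsto_imp_eventually_ne[OF ucont]) (use nz in auto)
  moreover have "\<forall>\<^sub>F \<delta> in at 0. u (-1) (\<tau> + \<delta> / 2) \<noteq> u (-2) \<tau>"
    by (rule tendsto_imp_eventually_ne[OF ucont]) (use nz in auto)
  moreover have "\<forall>\<^sub>F \<delta> in at 0. \<delta> \<noteq> (0::real)"
    by (simp add: eventually_at_filter)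
  ultimately have ev: "\<forall>\<^sub>F \<delta> in at 0. C3_L2 (x \<delta>) \<noteq> 0 \<and> C3_M2 b0 b1 (g p) (g (p - \<delta>)) (x \<delta>) \<noteq> 0
      \<and> s (- \<delta>) / s \<delta> * (((R \<delta> - 1) - (A \<delta> - B \<delta>) / B \<delta>) / \<delta>) = (L \<delta> - M \<delta>) / \<delta>"
  proof eventually_elim
    case (elim \<delta>)
    have a: "u 0 (\<tau> + \<delta>) = u 0 \<tau> + \<delta> * s \<delta>" "u 0 (\<tau> - \<delta>) = u 0 \<tau> - \<delta> * s (- \<delta>)"
      using slope_mult[of \<delta> "u 0" \<tau>] slope_mult[of "- \<delta>" "u 0" \<tau>] by (simp_all add: s_def)
    have M1: "C3_M1 b0 b1 (g p) (g (p - \<delta>)) (x \<delta>) = - \<delta> * s (- \<delta>) * A \<delta>"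
      using C3_M1_skew_stencil[of u \<tau> \<delta> "g p" "g (p - \<delta>)" "K \<delta>" b0 b1] elim
      by (simp add: x A_def s_def gq)
    have M2: "C3_M2 b0 b1 (g p) (g (p - \<delta>)) (x \<delta>) = - \<delta> * s \<delta> * B \<delta>"
      using C3_M2_skew_stencil[of u \<tau> \<delta> "g p" "g (p - \<delta>)" "K \<delta>" b0 b1] elim
      by (simp add: x B_def s_def gq)
    \<comment> \<open>The middle factors of \<open>C3_L1\<close> and \<open>C3_L2\<close> are
      increments of \<open>u 0\<close> over the steps \<open>- \<delta>\<close> and
      \<open>\<delta>\<close>. They supply the same prefactors as in \<open>M1\<close> and
      \<open>M2\<close>, and \<open>- \<delta>\<close> cancels in both fractions.\<close>
    have L1: "C3_L1 (x \<delta>) = - \<delta> * s (- \<delta>) *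
        ((u 2 \<tau> - u 1 (\<tau> - \<delta> / 2)) * (u (-1) (\<tau> - \<delta> / 2) - u (-2) \<tau>))"
      by (simp add: C3_L1_def x skew_stencil_def a)
    have L2: "C3_L2 (x \<delta>) = - \<delta> * s \<delta> *
        ((u 2 \<tau> - u 1 (\<tau> + \<delta> / 2)) * (u (-1) (\<tau> + \<delta> / 2) - u (-2) \<tau>))"
      by (simp add: C3_L2_def x skew_stencil_def a)
    have "L \<delta> = s (- \<delta>) / s \<delta> * R \<delta>"
      using elim by (simp add: L C3_L_def L1 L2 R_def)
    moreover have "M \<delta> = s (- \<delta>) / s \<delta> * (A \<delta> / B \<delta>)"
      using elim by (simp add: M C3_M_def M1 M2)
    \<comment> \<open>Uses \<open>R - A / B = (R - 1) - (A - B) / B\<close>, which splits the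
      difference into two parts vanishing at 0.\<close>
    ultimately have "s (- \<delta>) / s \<delta> * (((R \<delta> - 1) - (A \<delta> - B \<delta>) / B \<delta>) / \<delta>) = (L \<delta> - M \<delta>) / \<delta>"
      using elim by (simp add: field_simps)
    then show ?case
      using elim by (simp add: L2 M2)
  qed
  \<comment> \<open>The bracket is 0 at \<delta> = 0, so its difference quotient is the bracket
    divided by \<delta>.\<close>
  have "(\<lambda>\<delta>. ((R \<delta> - 1) - (A \<delta> - B \<delta>) / B \<delta>) / \<delta>) \<midarrow>0\<rightarrow> c"
    using Drem by (simp add: DERIV_def R0 A0 B0)
  \<comment> \<open>The other factor already converges, so continuity of \<open>s\<close> at 0
    suffices for the prefactor, which tends to 1.\<close>
  then have "(\<lambda>\<delta>. s (- \<delta>) / s \<delta> * (((R \<delta> - 1) - (A \<delta> - B \<delta>) / B \<delta>) / \<delta>)) \<midarrow>0\<rightarrow>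
      deriv (u 0) \<tau> / deriv (u 0) \<tau> * c"
    by (intro tendsto_intros slim slim' nz)
  moreover have "\<forall>\<^sub>F \<delta> in at 0.
      s (- \<delta>) / s \<delta> * (((R \<delta> - 1) - (A \<delta> - B \<delta>) / B \<delta>) / \<delta>) = (L \<delta> - M \<delta>) / \<delta>"
    using ev by eventually_elim simp
  ultimately have "(\<lambda>\<delta>. (L \<delta> - M \<delta>) / \<delta>) \<midarrow>0\<rightarrow> deriv (u 0) \<tau> / deriv (u 0) \<tau> * c"
    by (rule Lim_transform_eventually)
  then have lim: "(\<lambda>\<delta>. (L \<delta> - M \<delta>) / \<delta>) \<midarrow>0\<rightarrow> c"
    using nz by simp
  have DG': "(G has_real_derivative deriv G \<tau>) (at \<tau>)"
    using DG by (simp add: DERIV_imp_deriv)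
  have "deriv (\<lambda>t. ln \<bar>G t\<bar>) \<tau> = deriv G \<tau> / G \<tau>"
    by (rule DERIV_imp_deriv[OF has_real_derivative_ln_abs[OF DG' nz(4)]])
  moreover have "G differentiable (at \<tau>)"
    using DG' real_differentiable_def by blast
  moreover have "\<forall>\<^sub>F \<delta> in at 0. C3_L2 (x \<delta>) \<noteq> 0 \<and> C3_M2 b0 b1 (g p) (g (p - \<delta>)) (x \<delta>) \<noteq> 0"
    using ev by eventually_elim simp
  ultimately show ?thesis
    using lim smallo_ident_iff_limit_zero[OF lim] by (simp add: c_def log_deriv_def) argo
qed

end
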